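(* Let $(X,d,\ll,\leq,\tau)$ be a locally causally closed and sufficiently causally connected Lorentzian pre-length space. Let $T: X \to \mathbb{R}$ be a locally anti-Lipschitz time function and suppose that $X$ is equipped with the null distance $d_T$ with respect to $T$ (i.e. the metric $d$ of $X$ is $d_T$). Assume that $(X,d_T)$ is complete and that $X$ has $\tau$-midpoints. Assume further that there exists $c \in (0,\frac{1}{2}]$ such that for any $p, q \in X$ with $p \ll q$ there is a $\tau$-midpoint $m$ of $p$ and $q$ such that $$(1-c)\, T(p) + c\, T(q) \leq T(m) \leq c\, T(p) + (1-c)\, T(q).$$ Then $X$ is causally geodesic.
   Context: A Lorentzian pre-length space is a tuple $(X,d,\ll,\leq,\tau)$ where $(X,d)$ is a metric space, $\leq$ is a reflexive and transitive relation on $X$, $\ll$ is a transitive relation contained in $\leq$, and $\tau: X\times X\to[0,\infty]$ is lower semicontinuous (with respect to $d$) such that $\tau(x,z)\geq\tau(x,y)+\tau(y,z)$ whenever $x\leq y\leq z$, $\tau(x,y)=0$ if $x\not\leq y$, and $\tau(x,y)>0$ if and only if $x\ll y$. Write $x<y$ if $x\leq y$ and $x\neq y$. Points $x,y$ are timelike related if $x\ll y$, and null related if $x\leq y$ but not $x\ll y$. All topological notions refer to the metric of $X$. A future-directed causal (resp. timelike) curve is a non-constant locally Lipschitz curve $\gamma:I\to X$, $I$ an interval, with $\gamma(s)\leq\gamma(t)$ (resp. $\gamma(s)\ll\gamma(t)$) for all $s<t$ in $I$; past-directed curves are defined with the relations reversed. Causal and timelike curves are future-directed unless stated otherwise. The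 $\tau$-length of a causal curve $\gamma:[a,b]\to X$ is $L_\tau(\gamma)=\inf\{\sum_{i=0}^{n-1}\tau(\gamma(t_i),\gamma(t_{i+1})) : a=t_0<t_1<\dots<t_n=b,\ n\in\mathbb{N}\}$. A causal curve $\gamma$ from $x$ to $y$ is a distance realizer if $L_\tau(\gamma)=\tau(x,y)$. $X$ is geodesic (strictly intrinsic) if for all $x\ll y$ there is a distance realizer from $x$ to $y$. $X$ is causally geodesic if it is geodesic and there also exists a causal curve between any pair of distinct null related points (from the earlier to the later one). $X$ is locally causally closed if every point has a neighbourhood $U$ such that $\leq|_{\bar U\times\bar U}$ is closed, i.e. if $p_n\to p$, $q_n\to q$, $p_n,q_n\in U$, $p,q\in\bar U$, $p_n\leq q_n$ for all $n$, then $p\leq q$. $X$ is causally path-connected if for all $x<y$ there is a causal curve from $x$ to $y$ and for all $x\ll y$ there is a timelike curve from $x$ to $y$. $X$ is sufficiently causally connected if it is path-connected, causally path-connected and every point lies on a timelike curve. For $x\ll z$, a point $y\in X$ is a $\tau$-midpoint of $x$ and $z$ if $\tau(x,y)=\frac12\tau(x,z)=\tau(y,z)$. $X$ has $\tau$-midpoints if any pair of points $x\ll z$ has a $\tau$-midpoint. A generalized time function is a function $T:X\to\mathbb{R}$ with $x<y\Rightarrow T(x)<T(y)$; a time function is a continuous generalized time function. $T$ is locally anti-Lipschitz if every point has a neighbourhood $U$ together with a metric $d_U:U\times U\to\mathbb{R}$ such that $T(y)-T(x)\geq d_U(x,y)$ for all $x,y\in U$ with $x\leq y$. A curve $\gamma:[a,b]\to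 X$ is piecewise causal if there is a partition $a=t_0<t_1<\dots<t_n=b$ such that each $\gamma|_{[t_i,t_{i+1}]}$ is a future-directed or past-directed causal curve. Its null length is $L_T(\gamma)=\sum_{i=0}^{n-1}|T(\gamma(t_{i+1}))-T(\gamma(t_i))|$. The null distance is $d_T(p,q)=\inf\{L_T(\gamma) : \gamma \text{ is piecewise causal from } p \text{ to } q\}$. *)

theory Defs
  imports "HOL-Analysis.Analysis"
begin

section \<open>Lorentzian pre-length spaces\<close>

definition lower_semicontinuous :: "('b::topological_space \<Rightarrow> ennreal) \<Rightarrow> bool" where
  "lower_semicontinuous f \<longleftrightarrow> (\<forall>c. open {x. c < f x})"

text \<open>
  The underlying metric space is the carrier of a type of class \<^class>\<open>metric_space\<close>;
  \<open>ll\<close> is the timelike and \<open>le\<close> the causal relation.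
\<close>

locale lorentzian_pre_length_space =
  fixes ll :: "'a::metric_space \<Rightarrow> 'a \<Rightarrow> bool"
    and le :: "'a \<Rightarrow> 'a \<Rightarrow> bool"
    and \<tau> :: "'a \<Rightarrow> 'a \<Rightarrow> ennreal"
  assumes le_refl: "le x x"
    and le_trans: "le x y \<Longrightarrow> le y z \<Longrightarrow> le x z"
    and ll_trans: "ll x y \<Longrightarrow> ll y z \<Longrightarrow> ll x z"
    and ll_imp_le: "ll x y \<Longrightarrow> le x y"
    and tau_lsc: "lower_semicontinuous (\<lambda>(x, y). \<tau> x y)"
    and tau_reverse_triangle: "le x y \<Longrightarrow> le y z \<Longrightarrow> \<tau> x y + \<tau> y z \<le> \<tau> x z"
    and tau_eq_0: "\<not> le x y \<Longrightarrow> \<tau> x y = 0"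
    and tau_pos_iff: "0 < \<tau> x y \<longleftrightarrow> ll x y"

definition strictly_before :: "('a \<Rightarrow> 'a \<Rightarrow> bool) \<Rightarrow> 'a \<Rightarrow> 'a \<Rightarrow> bool" where
  "strictly_before le x y \<longleftrightarrow> le x y \<and> x \<noteq> y"

definition null_related :: "('a \<Rightarrow> 'a \<Rightarrow> bool) \<Rightarrow> ('a \<Rightarrow> 'a \<Rightarrow> bool) \<Rightarrow> 'a \<Rightarrow> 'a \<Rightarrow> bool" where
  "null_related ll le x y \<longleftrightarrow> le x y \<and> \<not> ll x y"


section \<open>Causal curves and their length\<close>

definition locally_lipschitz_on :: "real set \<Rightarrow> (real \<Rightarrow> 'a::metric_space) \<Rightarrow> bool" where
  "locally_lipschitz_on I \<gamma> \<longleftrightarrow> (\<forall>t\<in>I. \<exists>u>0. \<exists>L. L-lipschitz_on (cball t u \<inter> I) \<gamma>)"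

text \<open>
  \<open>R\<close> is the causal relation for causal curves and the timelike relation for timelike curves
  (future-directed), and the converse relation for past-directed curves.
\<close>

definition directed_curve ::
    "('a::metric_space \<Rightarrow> 'a \<Rightarrow> bool) \<Rightarrow> real set \<Rightarrow> (real \<Rightarrow> 'a) \<Rightarrow> bool" where
  "directed_curve R I \<gamma> \<longleftrightarrow>
     is_interval I \<and> \<not> \<gamma> constant_on I \<and> locally_lipschitz_on I \<gamma> \<and>
     (\<forall>s\<in>I. \<forall>t\<in>I. s < t \<longrightarrow> R (\<gamma> s) (\<gamma> t))"

definition directed_curve_from_to ::
    "('a::metric_space \<Rightarrow> 'a \<Rightarrow> bool) \<Rightarrow> real \<Rightarrow> real \<Rightarrow> (real \<Rightarrow> 'a) \<Rightarrow> 'a \<Rightarrow> 'a \<Rightarrow> bool" where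
  "directed_curve_from_to R a b \<gamma> x y \<longleftrightarrow>
     a \<le> b \<and> directed_curve R {a..b} \<gamma> \<and> \<gamma> a = x \<and> \<gamma> b = y"

definition is_partition :: "real \<Rightarrow> real \<Rightarrow> nat \<Rightarrow> (nat \<Rightarrow> real) \<Rightarrow> bool" where
  "is_partition a b n t \<longleftrightarrow> t 0 = a \<and> t n = b \<and> (\<forall>i<n. t i < t (Suc i))"

definition tau_length ::
    "('a \<Rightarrow> 'a \<Rightarrow> ennreal) \<Rightarrow> real \<Rightarrow> real \<Rightarrow> (real \<Rightarrow> 'a) \<Rightarrow> ennreal" where
  "tau_length \<tau> a b \<gamma> =
     Inf {(\<Sum>i<n. \<tau> (\<gamma> (t i)) (\<gamma> (t (Suc i)))) | n t. is_partition a b n t}"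

definition distance_realizer ::
    "('a::metric_space \<Rightarrow> 'a \<Rightarrow> bool) \<Rightarrow> ('a \<Rightarrow> 'a \<Rightarrow> ennreal) \<Rightarrow>
     real \<Rightarrow> real \<Rightarrow> (real \<Rightarrow> 'a) \<Rightarrow> 'a \<Rightarrow> 'a \<Rightarrow> bool" where
  "distance_realizer le \<tau> a b \<gamma> x y \<longleftrightarrow>
     directed_curve_from_to le a b \<gamma> x y \<and> tau_length \<tau> a b \<gamma> = \<tau> x y"

definition geodesic_space ::
    "('a::metric_space \<Rightarrow> 'a \<Rightarrow> bool) \<Rightarrow> ('a \<Rightarrow> 'a \<Rightarrow> bool) \<Rightarrow> ('a \<Rightarrow> 'a \<Rightarrow> ennreal) \<Rightarrow> bool" where
  "geodesic_space ll le \<tau> \<longleftrightarrow>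
     (\<forall>x y. ll x y \<longrightarrow> (\<exists>a b \<gamma>. distance_realizer le \<tau> a b \<gamma> x y))"

definition causally_geodesic ::
    "('a::metric_space \<Rightarrow> 'a \<Rightarrow> bool) \<Rightarrow> ('a \<Rightarrow> 'a \<Rightarrow> bool) \<Rightarrow> ('a \<Rightarrow> 'a \<Rightarrow> ennreal) \<Rightarrow> bool" where
  "causally_geodesic ll le \<tau> \<longleftrightarrow>
     geodesic_space ll le \<tau> \<and>
     (\<forall>x y. null_related ll le x y \<and> x \<noteq> y \<longrightarrow> (\<exists>a b \<gamma>. directed_curve_from_to le a b \<gamma> x y))"


section \<open>Causality conditions and midpoints\<close>

definition locally_causally_closed :: "('a::metric_space \<Rightarrow> 'a \<Rightarrow> bool) \<Rightarrow> bool" where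
  "locally_causally_closed le \<longleftrightarrow>
     (\<forall>x. \<exists>U. x \<in> interior U \<and>
        (\<forall>P Q p q. (\<forall>n::nat. P n \<in> U \<and> Q n \<in> U \<and> le (P n) (Q n)) \<and>
           P \<longlonglongrightarrow> p \<and> Q \<longlonglongrightarrow> q \<and> p \<in> closure U \<and> q \<in> closure U \<longrightarrow> le p q))"

definition causally_path_connected ::
    "('a::metric_space \<Rightarrow> 'a \<Rightarrow> bool) \<Rightarrow> ('a \<Rightarrow> 'a \<Rightarrow> bool) \<Rightarrow> bool" where
  "causally_path_connected ll le \<longleftrightarrow>
     (\<forall>x y. strictly_before le x y \<longrightarrow> (\<exists>a b \<gamma>. directed_curve_from_to le a b \<gamma> x y)) \<and>
     (\<forall>x y. ll x y \<longrightarrow> (\<exists>a b \<gamma>. directed_curve_from_to ll a b \<gamma> x y))"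

definition sufficiently_causally_connected ::
    "('a::metric_space \<Rightarrow> 'a \<Rightarrow> bool) \<Rightarrow> ('a \<Rightarrow> 'a \<Rightarrow> bool) \<Rightarrow> bool" where
  "sufficiently_causally_connected ll le \<longleftrightarrow>
     path_connected (UNIV :: 'a set) \<and> causally_path_connected ll le \<and>
     (\<forall>x. \<exists>I \<gamma>. directed_curve ll I \<gamma> \<and> x \<in> \<gamma> ` I)"

definition tau_midpoint :: "('a \<Rightarrow> 'a \<Rightarrow> ennreal) \<Rightarrow> 'a \<Rightarrow> 'a \<Rightarrow> 'a \<Rightarrow> bool" where
  "tau_midpoint \<tau> x z y \<longleftrightarrow> \<tau> x y = \<tau> x z / 2 \<and> \<tau> y z = \<tau> x z / 2"

definition has_tau_midpoints :: "('a \<Rightarrow> 'a \<Rightarrow> bool) \<Rightarrow> ('a \<Rightarrow> 'a \<Rightarrow> ennreal) \<Rightarrow> bool" where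
  "has_tau_midpoints ll \<tau> \<longleftrightarrow> (\<forall>x z. ll x z \<longrightarrow> (\<exists>y. tau_midpoint \<tau> x z y))"


section \<open>Time functions and the null distance\<close>

definition is_generalized_time_function :: "('a \<Rightarrow> 'a \<Rightarrow> bool) \<Rightarrow> ('a \<Rightarrow> real) \<Rightarrow> bool" where
  "is_generalized_time_function le T \<longleftrightarrow> (\<forall>x y. strictly_before le x y \<longrightarrow> T x < T y)"

definition is_time_function :: "('a::metric_space \<Rightarrow> 'a \<Rightarrow> bool) \<Rightarrow> ('a \<Rightarrow> real) \<Rightarrow> bool" where
  "is_time_function le T \<longleftrightarrow> is_generalized_time_function le T \<and> continuous_on UNIV T"

text \<open>
  The metric \<open>dU\<close> on the neighbourhood \<open>U\<close> need not be related to the metric of the space.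
\<close>

definition locally_anti_lipschitz ::
    "('a::metric_space \<Rightarrow> 'a \<Rightarrow> bool) \<Rightarrow> ('a \<Rightarrow> real) \<Rightarrow> bool" where
  "locally_anti_lipschitz le T \<longleftrightarrow>
     (\<forall>p. \<exists>U dU. p \<in> interior U \<and> Metric_space U dU \<and>
        (\<forall>x\<in>U. \<forall>y\<in>U. le x y \<longrightarrow> dU x y \<le> T y - T x))"

definition piecewise_causal ::
    "('a::metric_space \<Rightarrow> 'a \<Rightarrow> bool) \<Rightarrow> real \<Rightarrow> real \<Rightarrow> nat \<Rightarrow> (nat \<Rightarrow> real) \<Rightarrow> (real \<Rightarrow> 'a) \<Rightarrow> bool"
  where
  "piecewise_causal le a b n t \<gamma> \<longleftrightarrow>
     0 < n \<and> is_partition a b n t \<and>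
     (\<forall>i<n. directed_curve le {t i..t (Suc i)} \<gamma> \<or> directed_curve (le\<inverse>\<inverse>) {t i..t (Suc i)} \<gamma>)"

definition null_length ::
    "('a \<Rightarrow> real) \<Rightarrow> nat \<Rightarrow> (nat \<Rightarrow> real) \<Rightarrow> (real \<Rightarrow> 'a) \<Rightarrow> real" where
  "null_length T n t \<gamma> = (\<Sum>i<n. \<bar>T (\<gamma> (t (Suc i))) - T (\<gamma> (t i))\<bar>)"

text \<open>
  The null length is computed along a partition witnessing that the curve is piecewise causal.
  For a generalized time function it does not depend on the choice of that partition, so
  taking the infimum over curves and partitions is the infimum over curves. The value is
  \<open>\<infinity>\<close> if there is no piecewise causal curve from \<open>p\<close> to \<open>q\<close>.
\<close>

definition null_distance ::
    "('a::metric_space \<Rightarrow> 'a \<Rightarrow> bool) \<Rightarrow> ('a \<Rightarrow> real) \<Rightarrow> 'a \<Rightarrow> 'a \<Rightarrow> ereal" where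
  "null_distance le T p q =
     Inf {ereal (null_length T n t \<gamma>) | a b n t \<gamma>.
            piecewise_causal le a b n t \<gamma> \<and> \<gamma> a = p \<and> \<gamma> b = q}"

end

theory Submission
  imports Defs
begin

text \<open>
  Null related points are joined by a causal curve because the space is causally path-connected, so
  the content is a distance realizer between points \<open>x\<close> and \<open>y\<close> with \<open>ll x y\<close>.

  A causal curve from \<open>p\<close> to \<open>q\<close> has null length \<open>T q - T p\<close>, so with the null distance as metric
  \<open>dist p q \<le> T q - T p\<close> whenever \<open>le p q\<close> (\<open>dist_le_time_difference\<close>). Iterating the choice of
  midpoints, starting from \<open>x\<close> and \<open>y\<close>, gives points at all dyadic parameters in \<open>[0, 1]\<close>. They
  form a chain for \<open>le\<close>, and between the parameters \<open>d < e\<close> the time separation is at least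
  \<open>(e - d) \<tau>(x, y)\<close> (\<open>dyadic_chain_tau\<close>). In the dyadic parameter the chain would in general be
  only Hoelder continuous; parametrized by \<open>T\<close> it is 1-Lipschitz. The bound with \<open>c\<close> makes the
  time gaps at level \<open>n\<close> at most \<open>(1 - c)^n (T y - T x)\<close>, so the times of the chain are dense in
  \<open>[T x, T y]\<close> (\<open>dyadic_chain_dense\<close>). By completeness the chain therefore extends to a
  1-Lipschitz curve on this interval, and local closedness makes the extension causal
  (\<open>causal_chain_curve\<close>).

  The curve realizes the distance (\<open>ex_distance_realizer\<close>): let \<open>F s\<close> be the supremum of the dyadic
  parameters whose point has time at most \<open>s\<close>. Inserting chain points between the points at times
  \<open>s < t\<close>, the reverse triangle inequality bounds their separation below by
  \<open>(F t - F s) \<tau>(x, y)\<close>. Along a partition these bounds telescope to \<open>\<tau>(x, y)\<close>. The argument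
  covers \<open>\<tau>(x, y) = \<infinity>\<close> as well.
\<close>


section \<open>Causal relations, time and the null distance\<close>

text \<open>
  A causal curve from \<open>p\<close> to \<open>q\<close> is a piecewise causal curve with a single piece, so it competes
  in the infimum defining the null distance.
\<close>

lemma dist_le_time_difference:
  fixes le :: "'a::metric_space \<Rightarrow> 'a \<Rightarrow> bool" and T :: "'a \<Rightarrow> real"
  assumes conn: "causally_path_connected ll le"
    and time: "is_generalized_time_function le T"
    and null: "\<And>p q. ereal (dist p q) = null_distance le T p q"
    and "le p q"
  shows "dist p q \<le> T q - T p"
proof (cases "p = q")
  case False
  with \<open>le p q\<close> have before: "strictly_before le p q"
    by (simp add: strictly_before_def)
  then obtain a b \<gamma> where \<gamma>: "directed_curve_from_to le a b \<gamma> p q"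
    using conn unfolding causally_path_connected_def by blast
  then have ab: "a < b" and ends: "\<gamma> a = p" "\<gamma> b = q" and dir: "directed_curve le {a..b} \<gamma>"
    using False by (auto simp: directed_curve_from_to_def less_le)
  define t where "t i = (if i = 0 then a else b)" for i :: nat
  have "piecewise_causal le a b 1 t \<gamma>"
    using ab dir by (simp add: piecewise_causal_def is_partition_def t_def)
  then have "null_distance le T p q \<le> ereal (null_length T 1 t \<gamma>)"
    unfolding null_distance_def using ends by (intro Inf_lower) blast
  also have "null_length T 1 t \<gamma> = T q - T p"
    using time before ends
    by (force simp: null_length_def t_def is_generalized_time_function_def)
  finally show ?thesis
    by (simp flip: null)
qed simp

text \<open>
  A timelike curve is non-constant, so it meets a point different from its initial point, and time
  has to increase strictly up to there. In particular there are no timelike loops.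
\<close>

lemma timelike_imp_time_less:
  fixes le :: "'a::metric_space \<Rightarrow> 'a \<Rightarrow> bool" and T :: "'a \<Rightarrow> real"
  assumes conn: "causally_path_connected ll le"
    and time: "is_generalized_time_function le T"
    and ll_le: "\<And>x y. ll x y \<Longrightarrow> le x y"
    and "ll p q"
  shows "T p < T q"
proof -
  obtain a b \<gamma> where \<gamma>: "directed_curve_from_to ll a b \<gamma> p q"
    using conn \<open>ll p q\<close> unfolding causally_path_connected_def by blast
  then have nc: "\<not> \<gamma> constant_on {a..b}" and ends: "\<gamma> a = p" "\<gamma> b = q" "a \<le> b"
    and ord: "\<And>s t. \<lbrakk>s \<in> {a..b}; t \<in> {a..b}; s < t\<rbrakk> \<Longrightarrow> ll (\<gamma> s) (\<gamma> t)"
    by (auto simp: directed_curve_from_to_def directed_curve_def)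
  from nc obtain s where s: "s \<in> {a..b}" "\<gamma> s \<noteq> p"
    unfolding constant_on_def by blast
  then have "le p (\<gamma> s)" "\<gamma> s = q \<or> le (\<gamma> s) q"
    using ends ord[of a s] ord[of s b] ll_le by (auto simp: less_le)
  moreover have "le u v \<Longrightarrow> T u \<le> T v" "le u v \<Longrightarrow> u \<noteq> v \<Longrightarrow> T u < T v" for u v
    using time by (cases "u = v"; auto simp: is_generalized_time_function_def
        strictly_before_def intro: less_imp_le)+
  ultimately show ?thesis
    using s(2) by (metis order_less_le_trans order_refl)
qed


section \<open>Curves from chains that are dense in time\<close>

text \<open>
  What the construction uses of the null distance is \<open>dist_le_T\<close>, and of timelike curves that time
  increases strictly along \<open>ll\<close>. A choice of midpoints is fixed so that they can be iterated.
\<close>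

locale midpoint_time_space = lorentzian_pre_length_space ll le \<tau>
  for ll le :: "'a::metric_space \<Rightarrow> 'a \<Rightarrow> bool" and \<tau> +
  fixes T :: "'a \<Rightarrow> real" and c :: real and mid :: "'a \<Rightarrow> 'a \<Rightarrow> 'a"
  assumes closed_le: "locally_causally_closed le"
    and complete_space: "complete (UNIV :: 'a set)"
    and continuous_T: "continuous_on UNIV T"
    and dist_le_T: "le p q \<Longrightarrow> dist p q \<le> T q - T p"
    and ll_imp_T_less: "ll p q \<Longrightarrow> T p < T q"
    and c_pos: "0 < c"
    and c_less_1: "c < 1"
    and midpoint_mid: "ll p q \<Longrightarrow> tau_midpoint \<tau> p q (mid p q)"
    and T_mid_ge: "ll p q \<Longrightarrow> (1 - c) * T p + c * T q \<le> T (mid p q)"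
    and T_mid_le: "ll p q \<Longrightarrow> T (mid p q) \<le> c * T p + (1 - c) * T q"
begin

lemma le_imp_T_le: "le p q \<Longrightarrow> T p \<le> T q"
  using dist_le_T[of p q] zero_le_dist[of p q] by linarith

text \<open>
  On a chain, and by continuity on its closure \<open>C\<close>, distances are at most time differences. So \<open>T\<close>
  is injective on \<open>C\<close> with a 1-Lipschitz inverse, and by completeness its image is closed, hence
  all of \<open>{a..b}\<close>; the curve is that inverse, that is, the chain parametrized by time. Closedness of
  \<open>le\<close> is only local, but this is enough: from a point of \<open>C\<close> one only has to reach nearby
  points of the chain, and between these the order is known.
\<close>

lemma causal_chain_curve:
  assumes chain: "\<And>p q. p \<in> A \<Longrightarrow> q \<in> A \<Longrightarrow> le p q \<or> le q p"
    and image: "T ` A \<subseteq> {a..b}"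
    and dense: "{a..b} \<subseteq> closure (T ` A)"
  obtains \<sigma> where "1-lipschitz_on {a..b} \<sigma>"
    and "\<And>p. p \<in> A \<Longrightarrow> \<sigma> (T p) = p"
    and "\<And>s t. \<lbrakk>s \<in> {a..b}; t \<in> {a..b}; s < t\<rbrakk> \<Longrightarrow> le (\<sigma> s) (\<sigma> t)"
proof -
  define C where "C = closure A"
  have AC: "A \<subseteq> C"
    by (simp add: C_def closure_subset)
  have A_le: "le p q" if "p \<in> A" "q \<in> A" "T p < T q" for p q
    using chain[OF that(1,2)] le_imp_T_le[of q p] that(3) by auto
  have A_dist: "dist p q \<le> \<bar>T p - T q\<bar>" if "p \<in> A" "q \<in> A" for p q
    using chain[OF that] dist_le_T[of p q] dist_le_T[of q p] by (auto simp: dist_commute)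
  have C_dist: "dist p q \<le> \<bar>T p - T q\<bar>" if "p \<in> C" "q \<in> C" for p q
  proof -
    have "closed {z. dist (fst z) (snd z) \<le> \<bar>T (fst z) - T (snd z)\<bar>}"
      by (intro closed_Collect_le continuous_intros
          continuous_on_compose2[OF continuous_T]) auto
    then have "closure (A \<times> A) \<subseteq> {z. dist (fst z) (snd z) \<le> \<bar>T (fst z) - T (snd z)\<bar>}"
      using A_dist by (intro closure_minimal) auto
    then show ?thesis
      using that by (auto simp: closure_Times C_def)
  qed
  have T_C_le: "T ` C \<subseteq> {a..b}"
  proof -
    have "T ` closure A \<subseteq> closure (T ` A)"
      using continuous_on_subset[OF continuous_T] by (intro image_closure_subset) (auto simp: closure_subset)
    also have "\<dots> \<subseteq> {a..b}"
      using image by (intro closure_minimal) auto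
    finally show ?thesis by (simp add: C_def)
  qed
  have onto: "\<exists>p\<in>C. T p = s" if s: "s \<in> {a..b}" for s
  proof -
    from s dense have "s \<in> closure (T ` A)"
      by blast
    then obtain r where r: "\<And>n. r n \<in> T ` A" "r \<longlonglongrightarrow> s"
      unfolding closure_sequential by blast
    have "\<forall>n. \<exists>p. p \<in> A \<and> r n = T p"
      using r(1) by blast
    then obtain u where u: "\<And>n. u n \<in> A" "\<And>n. r n = T (u n)"
      by metis
    have "Cauchy u"
    proof (rule metric_CauchyI)
      fix e :: real assume "0 < e"
      then obtain M where "\<And>m n. m \<ge> M \<Longrightarrow> n \<ge> M \<Longrightarrow> dist (r m) (r n) < e"
        using LIMSEQ_imp_Cauchy[OF r(2)] metric_CauchyD by blast
      then show "\<exists>M. \<forall>m\<ge>M. \<forall>n\<ge>M. dist (u m) (u n) < e"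
        using A_dist[OF u(1) u(1)] u(2) by (metis dist_real_def le_less_trans)
    qed
    then obtain p where p: "u \<longlonglongrightarrow> p"
      using complete_space by (auto simp: complete_def)
    have "p \<in> C"
      using u(1) p unfolding C_def closure_sequential by blast
    moreover have "(\<lambda>n. T (u n)) \<longlonglongrightarrow> T p"
      using continuous_on_tendsto_compose[OF continuous_T p] by simp
    then have "T p = s"
      using r(2) LIMSEQ_unique by (simp flip: u(2))
    ultimately show ?thesis by blast
  qed
  have inj: "p = q" if "p \<in> C" "q \<in> C" "T p = T q" for p q
    using C_dist[OF that(1,2)] that(3) by simp
  obtain \<sigma> where \<sigma>: "\<And>s. s \<in> {a..b} \<Longrightarrow> \<sigma> s \<in> C \<and> T (\<sigma> s) = s"
    using onto by metis
  have dense': "\<exists>p\<in>A. u < T p \<and> T p < v" if "a \<le> u" "u < v" "v \<le> b" for u v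
  proof -
    have "(u + v) / 2 \<in> {a..b}"
      using that by simp
    then have "(u + v) / 2 \<in> closure (T ` A)"
      using dense by blast
    moreover have "0 < (v - u) / 2"
      using that by simp
    ultimately obtain p where p: "p \<in> A" "\<bar>T p - (u + v) / 2\<bar> < (v - u) / 2"
      unfolding closure_approachable dist_real_def by blast
    have "u < T p" "T p < v"
      using abs_less_iff[THEN iffD1, OF p(2)] by (simp_all add: field_simps)
    then show ?thesis
      using p(1) by blast
  qed
  have near: "\<exists>e>0. \<forall>q\<in>A. (T p < T q \<and> T q < T p + e \<longrightarrow> le p q) \<and>
                            (T p - e < T q \<and> T q < T p \<longrightarrow> le q p)"
    if p: "p \<in> C" for p
  proof -
    from closed_le obtain U where U: "p \<in> interior U"
      and cl: "\<And>P Q u v. \<lbrakk>\<And>n::nat. P n \<in> U \<and> Q n \<in> U \<and> le (P n) (Q n);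
                P \<longlonglongrightarrow> u; Q \<longlonglongrightarrow> v; u \<in> closure U; v \<in> closure U\<rbrakk> \<Longrightarrow> le u v"
      unfolding locally_causally_closed_def by meson
    then obtain e where e: "e > 0" "ball p e \<subseteq> U"
      by (meson mem_interior)
    have pU: "p \<in> closure U"
      using U interior_subset closure_subset by blast
    have "(T p < T q \<longrightarrow> le p q) \<and> (T q < T p \<longrightarrow> le q p)"
      if q: "q \<in> A" "\<bar>T p - T q\<bar> < e" for q
    proof -
      have qU: "q \<in> U"
        using C_dist[OF p, of q] q AC e(2) by (auto simp: subset_iff)
      from p obtain w where w: "\<And>n. w n \<in> A" "w \<longlonglongrightarrow> p"
        unfolding C_def closure_sequential by blast
      have Tw: "(\<lambda>n. T (w n)) \<longlonglongrightarrow> T p"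
        using continuous_on_tendsto_compose[OF continuous_T w(2)] by simp
      have wU: "\<forall>\<^sub>F n in sequentially. w n \<in> U"
        using tendstoD[OF w(2) e(1)] e(2)
        by (auto elim!: eventually_mono simp: dist_commute subset_iff)
      show ?thesis
      proof (intro conjI impI)
        assume "T p < T q"
        with Tw have "\<forall>\<^sub>F n in sequentially. T (w n) < T q"
          by (rule order_tendstoD)
        with wU have "\<forall>\<^sub>F n in sequentially. w n \<in> U \<and> le (w n) q"
          by eventually_elim (use A_le w(1) q(1) in blast)
        then obtain N where "\<And>n. n \<ge> N \<Longrightarrow> w n \<in> U \<and> le (w n) q"
          by (auto simp: eventually_sequentially)
        then show "le p q"
          using cl[of "\<lambda>n. w (n + N)" "\<lambda>_. q" p q] w(2) qU pU closure_subset
          by (auto intro: LIMSEQ_ignore_initial_segment)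
      next
        assume "T q < T p"
        with Tw have "\<forall>\<^sub>F n in sequentially. T q < T (w n)"
          by (rule order_tendstoD)
        with wU have "\<forall>\<^sub>F n in sequentially. w n \<in> U \<and> le q (w n)"
          by eventually_elim (use A_le w(1) q(1) in blast)
        then obtain N where "\<And>n. n \<ge> N \<Longrightarrow> w n \<in> U \<and> le q (w n)"
          by (auto simp: eventually_sequentially)
        then show "le q p"
          using cl[of "\<lambda>_. q" "\<lambda>n. w (n + N)" q p] w(2) qU pU closure_subset
          by (auto intro: LIMSEQ_ignore_initial_segment)
      qed
    qed
    then show ?thesis
      using e(1) by (intro exI[of _ e]) (auto simp: abs_less_iff)
  qed
  show ?thesis
  proof
    show "1-lipschitz_on {a..b} \<sigma>"
      using C_dist \<sigma> by (intro lipschitz_onI) (auto simp: dist_real_def, metis atLeastAtMost_iff)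
    show "\<sigma> (T p) = p" if "p \<in> A" for p
      using \<sigma>[of "T p"] inj[of "\<sigma> (T p)" p] image AC that by blast
    fix s t assume st: "s \<in> {a..b}" "t \<in> {a..b}" "s < t"
    obtain e where e: "e > 0" "\<And>q. \<lbrakk>q \<in> A; s < T q; T q < s + e\<rbrakk> \<Longrightarrow> le (\<sigma> s) q"
      using near[of "\<sigma> s"] \<sigma>[OF st(1)] by metis
    obtain e' where e': "e' > 0" "\<And>q. \<lbrakk>q \<in> A; t - e' < T q; T q < t\<rbrakk> \<Longrightarrow> le q (\<sigma> t)"
      using near[of "\<sigma> t"] \<sigma>[OF st(2)] by metis
    obtain p where p: "p \<in> A" "s < T p" "T p < min t (s + e)"
      using dense'[of s "min t (s + e)"] st e(1) by (auto simp: min_le_iff_disj)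
    obtain q where q: "q \<in> A" "max (T p) (t - e') < T q" "T q < t"
      using dense'[of "max (T p) (t - e')" t] st e'(1) p by (auto simp: le_max_iff_disj)
    have "le (\<sigma> s) p" "le p q" "le q (\<sigma> t)"
      using e(2)[of p] A_le[of p q] e'(2)[of q] p q by auto
    then show "le (\<sigma> s) (\<sigma> t)"
      by (blast intro: le_trans)
  qed
qed

end


section \<open>Iterated midpoints\<close>

text \<open>
  \<open>dyadic_chain mid x y n k\<close> is the point at the dyadic parameter \<open>k / 2 ^ n\<close>, for \<open>k \<le> 2 ^ n\<close>.
\<close>

fun dyadic_chain :: "('a \<Rightarrow> 'a \<Rightarrow> 'a) \<Rightarrow> 'a \<Rightarrow> 'a \<Rightarrow> nat \<Rightarrow> nat \<Rightarrow> 'a" where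
  "dyadic_chain mid x y 0 k = (if k = 0 then x else y)"
| "dyadic_chain mid x y (Suc n) k =
     (if even k then dyadic_chain mid x y n (k div 2)
      else mid (dyadic_chain mid x y n (k div 2)) (dyadic_chain mid x y n (Suc (k div 2))))"

lemma dyadic_chain_0: "dyadic_chain mid x y n 0 = x"
  by (induction n) auto

lemma dyadic_chain_top: "dyadic_chain mid x y n (2 ^ n) = y"
  by (induction n) auto

lemma dyadic_chain_refine: "dyadic_chain mid x y (n + i) (k * 2 ^ i) = dyadic_chain mid x y n k"
  by (induction i) auto

lemma ex_dyadic_between:
  fixes u v :: real
  assumes "0 \<le> u" "u < v" "v \<le> 1"
  obtains n i :: nat where "i \<le> 2 ^ n" "u < real i / 2 ^ n" "real i / 2 ^ n < v"
proof -
  obtain n :: nat where n: "(1/2) ^ n < v - u"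
    using real_arch_pow_inv[of "v - u" "1/2"] assms by auto
  define i where "i = Suc (nat \<lfloor>u * 2 ^ n\<rfloor>)"
  have "u * 2 ^ n < real i" "real i \<le> u * 2 ^ n + 1"
    using assms by (auto simp: i_def) linarith+
  moreover have "u * 2 ^ n + 1 < v * 2 ^ n"
    using n by (simp add: field_simps power_one_over)
  moreover have "v * 2 ^ n \<le> 2 ^ n"
    using assms by simp
  ultimately have "u * 2 ^ n < real i \<and> real i < v * 2 ^ n \<and> real i \<le> 2 ^ n"
    by linarith
  then have "u < real i / 2 ^ n" "real i / 2 ^ n < v" "real i \<le> 2 ^ n"
    by (auto simp: pos_less_divide_eq pos_divide_less_eq)
  then show ?thesis
    using that[of i n] by (metis of_nat_le_iff of_nat_numeral of_nat_power)
qed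

lemma ennreal_half: "(M :: ennreal) / 2 = ennreal (1 / 2) * M"
  by (simp add: divide_ennreal_def mult.commute inverse_ennreal[symmetric] flip: ennreal_numeral)

context midpoint_time_space
begin

text \<open>
  Each bisection halves \<open>\<tau>\<close> exactly, while the time increment shrinks at least by the
  factor \<open>1 - c\<close>.
\<close>

lemma dyadic_chain_step:
  assumes "ll x y" "k < 2 ^ n"
  defines "P \<equiv> dyadic_chain mid x y"
  shows "\<tau> (P n k) (P n (Suc k)) = ennreal (1 / 2 ^ n) * \<tau> x y \<and>
         T (P n (Suc k)) - T (P n k) \<le> (1 - c) ^ n * (T y - T x)"
  using assms(2)
proof (induction n arbitrary: k)
  case 0
  then show ?case by (simp add: P_def)
next
  case (Suc n)
  define j where "j = k div 2"
  have j: "j < 2 ^ n"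
    using Suc.prems by (auto simp: j_def)
  let ?p = "P n j" and ?q = "P n (Suc j)"
  note IH = Suc.IH[OF j]
  have "0 < \<tau> x y"
    using assms(1) tau_pos_iff by simp
  then have ll: "ll ?p ?q"
    using IH by (simp flip: tau_pos_iff add: ennreal_zero_less_mult_iff)
  have half: "\<tau> ?p ?q / 2 = ennreal (1 / 2 ^ Suc n) * \<tau> x y"
  proof -
    have "\<tau> ?p ?q / 2 = (ennreal (1 / 2) * ennreal (1 / 2 ^ n)) * \<tau> x y"
      using IH by (simp only: ennreal_half mult.assoc)
    also have "ennreal (1 / 2) * ennreal (1 / 2 ^ n) = ennreal (1 / 2 ^ Suc n)"
      by (subst ennreal_mult[symmetric]) auto
    finally show ?thesis .
  qed
  have \<tau>: "\<tau> ?p (mid ?p ?q) = ennreal (1 / 2 ^ Suc n) * \<tau> x y"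
      "\<tau> (mid ?p ?q) ?q = ennreal (1 / 2 ^ Suc n) * \<tau> x y"
    using midpoint_mid[OF ll] half by (auto simp: tau_midpoint_def)
  have "(1 - c) * (T ?q - T ?p) \<le> (1 - c) * ((1 - c) ^ n * (T y - T x))"
    using IH c_less_1 by (intro mult_left_mono) auto
  then have T: "T (mid ?p ?q) - T ?p \<le> (1 - c) ^ Suc n * (T y - T x)"
      "T ?q - T (mid ?p ?q) \<le> (1 - c) ^ Suc n * (T y - T x)"
    using T_mid_ge[OF ll] T_mid_le[OF ll] by (auto simp: algebra_simps)
  show ?case
  proof (cases "even k")
    case True
    then have "P (Suc n) k = ?p" "P (Suc n) (Suc k) = mid ?p ?q"
      by (auto simp: P_def j_def)
    then show ?thesis using \<tau> T by simp
  next
    case False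
    then have "P (Suc n) k = mid ?p ?q" "P (Suc n) (Suc k) = ?q"
      by (auto simp: P_def j_def elim!: oddE)
    then show ?thesis using \<tau> T by simp
  qed
qed

text \<open>
  The reverse triangle inequality adds up the steps of one level. Only the inequality is recorded,
  which is all that the lower bound on the length needs.
\<close>

lemma dyadic_chain_tau_level:
  assumes "ll x y" "i < j" "j \<le> 2 ^ n"
  defines "P \<equiv> dyadic_chain mid x y"
  shows "ennreal ((real j - real i) / 2 ^ n) * \<tau> x y \<le> \<tau> (P n i) (P n j) \<and> ll (P n i) (P n j)"
  using assms(2,3)
proof (induction j)
  case (Suc j)
  have step: "\<tau> (P n j) (P n (Suc j)) = ennreal (1 / 2 ^ n) * \<tau> x y"
    using dyadic_chain_step[of x y j n] assms(1) Suc.prems by (auto simp: P_def)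
  have pos: "0 < \<tau> x y"
    using assms(1) tau_pos_iff by simp
  with step have ll: "ll (P n j) (P n (Suc j))"
    by (simp flip: tau_pos_iff add: ennreal_zero_less_mult_iff)
  show ?case
  proof (cases "i = j")
    case True
    then show ?thesis using step ll by simp
  next
    case False
    then have IH: "ennreal ((real j - real i) / 2 ^ n) * \<tau> x y \<le> \<tau> (P n i) (P n j)"
        "ll (P n i) (P n j)"
      using Suc by auto
    have "(real (Suc j) - real i) / 2 ^ n = (real j - real i) / 2 ^ n + 1 / 2 ^ n"
      by (simp add: add_divide_distrib[symmetric])
    then have "ennreal ((real (Suc j) - real i) / 2 ^ n) * \<tau> x y
        = ennreal ((real j - real i) / 2 ^ n) * \<tau> x y + ennreal (1 / 2 ^ n) * \<tau> x y"
      using False Suc.prems by (simp only: distrib_right[symmetric]) (subst ennreal_plus, auto)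
    also have "\<dots> \<le> \<tau> (P n i) (P n j) + \<tau> (P n j) (P n (Suc j))"
      using IH step by (simp add: add_right_mono)
    also have "\<dots> \<le> \<tau> (P n i) (P n (Suc j))"
      using IH ll ll_imp_le tau_reverse_triangle by blast
    finally show ?thesis
      using IH ll ll_trans by blast
  qed
qed simp

text \<open>Parameters of different levels are compared after refining both to level \<open>n + m\<close>.\<close>

lemma dyadic_chain_tau:
  assumes "ll x y" "i \<le> 2 ^ n" "j \<le> 2 ^ m" "real i / 2 ^ n < real j / 2 ^ m"
  defines "P \<equiv> dyadic_chain mid x y"
  shows "ennreal (real j / 2 ^ m - real i / 2 ^ n) * \<tau> x y \<le> \<tau> (P n i) (P m j)"
    and "ll (P n i) (P m j)"
proof -
  have *: "P n i = P (n + m) (i * 2 ^ m)" "P m j = P (n + m) (j * 2 ^ n)"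
    using dyadic_chain_refine[of mid x y n m i] dyadic_chain_refine[of mid x y m n j]
    by (auto simp: P_def add.commute)
  have "real (i * 2 ^ m) < real (j * 2 ^ n)"
    using assms(4) by (simp add: field_simps)
  then have "i * 2 ^ m < j * 2 ^ n"
    by linarith
  moreover have "j * 2 ^ n \<le> 2 ^ (n + m)"
    using assms(3) by (simp add: power_add mult.commute)
  moreover have "(real (j * 2 ^ n) - real (i * 2 ^ m)) / 2 ^ (n + m)
      = real j / 2 ^ m - real i / 2 ^ n"
    by (simp add: field_simps power_add)
  ultimately show "ennreal (real j / 2 ^ m - real i / 2 ^ n) * \<tau> x y \<le> \<tau> (P n i) (P m j)"
    "ll (P n i) (P m j)"
    using dyadic_chain_tau_level[OF assms(1), of "i * 2 ^ m" "j * 2 ^ n" "n + m"] *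
    by (auto simp: P_def)
qed

lemma dyadic_chain_eq:
  assumes "real i / 2 ^ n = real j / 2 ^ m"
  shows "dyadic_chain mid x y n i = dyadic_chain mid x y m j"
proof -
  have "real (i * 2 ^ m) = real (j * 2 ^ n)"
    using assms by (simp add: field_simps)
  then have "i * 2 ^ m = j * 2 ^ n"
    by (simp only: of_nat_eq_iff)
  then show ?thesis
    by (metis add.commute dyadic_chain_refine)
qed

lemma dyadic_chain_total:
  assumes "ll x y" "i \<le> 2 ^ n" "j \<le> 2 ^ m"
  defines "P \<equiv> dyadic_chain mid x y"
  shows "le (P n i) (P m j) \<or> le (P m j) (P n i)"
  using dyadic_chain_tau(2)[OF assms(1-3)] dyadic_chain_tau(2)[OF assms(1,3,2)]
    dyadic_chain_eq[of i n j m x y] ll_imp_le le_refl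
  unfolding P_def by (metis linorder_less_linear)

lemma dyadic_chain_T_bounds:
  assumes "ll x y" "i \<le> 2 ^ n"
  shows "T (dyadic_chain mid x y n i) \<in> {T x..T y}"
proof -
  have "i = 0 \<or> T x \<le> T (dyadic_chain mid x y n i)"
    using dyadic_chain_tau_level[OF assms(1), of 0 i n] assms(2) ll_imp_T_less
    by (auto simp: dyadic_chain_0 intro: less_imp_le)
  moreover have "i = 2 ^ n \<or> T (dyadic_chain mid x y n i) \<le> T y"
    using dyadic_chain_tau_level[OF assms(1), of i "2 ^ n" n] assms(2) ll_imp_T_less
    by (auto simp: dyadic_chain_top intro: less_imp_le)
  ultimately show ?thesis
    using ll_imp_T_less[OF assms(1)] by (auto simp: dyadic_chain_0 dyadic_chain_top)
qed

text \<open>This is where the bound on the times of midpoints enters.\<close>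

lemma dyadic_chain_dense:
  assumes "ll x y"
  shows "{T x..T y} \<subseteq> closure (T ` {dyadic_chain mid x y n i |n i. i \<le> 2 ^ n})"
proof
  fix s assume s: "s \<in> {T x..T y}"
  let ?P = "dyadic_chain mid x y"
  show "s \<in> closure (T ` {?P n i |n i. i \<le> 2 ^ n})"
    unfolding closure_approachable
  proof (intro allI impI)
    fix e :: real assume "0 < e"
    have L: "0 < T y - T x"
      using ll_imp_T_less[OF assms] by simp
    obtain n where "(1 - c) ^ n < e / (T y - T x)"
      using real_arch_pow_inv[of "e / (T y - T x)" "1 - c"] c_pos \<open>0 < e\<close> L by auto
    then have n: "(1 - c) ^ n * (T y - T x) < e"
      using L by (simp add: field_simps)
    have "\<exists>i\<le>2 ^ n. dist (T (?P n i)) s < e"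
    proof (rule ccontr)
      assume far: "\<not> ?thesis"
      \<comment> \<open>The times of the level \<open>n\<close> points cannot jump over \<open>s\<close>, so they all stay below it.\<close>
      have "T (?P n i) \<le> s - e" if "i \<le> 2 ^ n" for i
        using that
      proof (induction i)
        case 0
        then show ?case
          using far[simplified, rule_format, of 0] s by (simp add: dyadic_chain_0 dist_real_def)
      next
        case (Suc i)
        then have "T (?P n (Suc i)) - T (?P n i) < e"
          using dyadic_chain_step[OF assms, of i n] n by auto
        with Suc have "T (?P n (Suc i)) < s"
          by auto
        then show ?case
          using far[simplified, rule_format, OF Suc.prems] by (simp add: dist_real_def)
      qed
      from this[of "2 ^ n"] show False
        using s \<open>0 < e\<close> by (simp add: dyadic_chain_top)
    qed
    then show "\<exists>r\<in>T ` {?P n i |n i. i \<le> 2 ^ n}. dist r s < e"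
      by blast
  qed
qed

end


section \<open>The length of the limit curve\<close>

lemma ennreal_mult_le_of_smaller_factors:
  fixes M K :: ennreal
  assumes "\<And>w. 0 < w \<Longrightarrow> w < l \<Longrightarrow> ennreal w * M \<le> K"
  shows "ennreal l * M \<le> K"
proof (cases "0 < l \<and> M \<noteq> 0")
  case True
  show ?thesis
  proof (cases "M = top")
    case True
    then show ?thesis
      using assms[of "l / 2"] \<open>0 < l \<and> M \<noteq> 0\<close> by (simp add: ennreal_mult_top top_unique)
  next
    case False
    then obtain m where m: "M = ennreal m" "0 < m"
      using \<open>0 < l \<and> M \<noteq> 0\<close> by (cases M) (auto simp: less_le)
    show ?thesis
    proof (cases K)
      case (real k)
      have "l * m \<le> k"
      proof (rule ccontr)
        assume "\<not> l * m \<le> k"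
        then have "max 0 (k / m) < l"
          using True m by (simp add: field_simps)
        then obtain w where w: "max 0 (k / m) < w" "w < l"
          using dense by blast
        have "0 < w"
          using w by simp
        then have "w * m \<le> k"
          using assms[of w] w m real by (simp add: ennreal_le_iff flip: ennreal_mult)
        then show False
          using w m by (simp add: field_simps)
      qed
      then show ?thesis
        using m real True by (simp add: ennreal_le_iff flip: ennreal_mult)
    qed simp
  qed
qed (auto simp: ennreal_neg)

text \<open>
  A lower bound on \<open>\<tau>\<close> by increments of a function of the parameter telescopes along every
  partition, so it passes to the infimum.
\<close>

lemma tau_length_ge_of_weight:
  assumes weight: "\<And>s t. \<lbrakk>s \<in> {a..b}; t \<in> {a..b}; s < t\<rbrakk> \<Longrightarrow>
      F s \<le> F t \<and> ennreal (F t - F s) * M \<le> \<tau> (\<gamma> s) (\<gamma> t)"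
  shows "ennreal (F b - F a) * M \<le> tau_length \<tau> a b \<gamma>"
  unfolding tau_length_def
proof (rule Inf_greatest, clarify)
  fix n t assume part: "is_partition a b n t"
  then have t_less: "\<And>i. i < n \<Longrightarrow> t i < t (Suc i)" and ends: "t 0 = a" "t n = b"
    by (auto simp: is_partition_def)
  have mono: "t i \<le> t j" if "i \<le> j" "j \<le> n" for i j
    using that
  proof (induction j rule: dec_induct)
    case (step m)
    with t_less[of m] show ?case by simp
  qed simp
  have mem: "t i \<in> {a..b}" if "i \<le> n" for i
    using mono[of 0 i] mono[of i n] ends that by auto
  have w: "F (t i) \<le> F (t (Suc i)) \<and>
      ennreal (F (t (Suc i)) - F (t i)) * M \<le> \<tau> (\<gamma> (t i)) (\<gamma> (t (Suc i)))" if "i < n" for i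
    using weight[of "t i" "t (Suc i)"] mem t_less that by auto
  have "ennreal (F b - F a) * M = ennreal (\<Sum>i<n. F (t (Suc i)) - F (t i)) * M"
    using sum_lessThan_telescope[of "\<lambda>i. F (t i)" n] ends by simp
  also have "\<dots> = (\<Sum>i<n. ennreal (F (t (Suc i)) - F (t i)) * M)"
    using w by (subst sum_ennreal[symmetric]) (auto simp: sum_distrib_right)
  also have "\<dots> \<le> (\<Sum>i<n. \<tau> (\<gamma> (t i)) (\<gamma> (t (Suc i))))"
    using w by (intro sum_mono) auto
  finally show "ennreal (F b - F a) * M \<le> (\<Sum>i<n. \<tau> (\<gamma> (t i)) (\<gamma> (t (Suc i))))" .
qed

context midpoint_time_space
begin

text \<open>
  The realizer is the time parametrization \<open>\<sigma>\<close> of the closed-up midpoint chain. The strict bounds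
  \<open>above\<close> and \<open>below\<close> say that dyadic parameters strictly between \<open>F s\<close> and \<open>F t\<close> belong to chain
  points whose time is strictly between \<open>s\<close> and \<open>t\<close>; inserting two of them bounds
  \<open>\<tau> (\<sigma> s) (\<sigma> t)\<close> from below.
\<close>

lemma ex_distance_realizer:
  assumes xy: "ll x y"
  obtains \<gamma> where "distance_realizer le \<tau> (T x) (T y) \<gamma> x y"
proof -
  let ?P = "dyadic_chain mid x y"
  define A where "A = {?P n i |n i. i \<le> 2 ^ n}"
  have Txy: "T x < T y"
    using ll_imp_T_less[OF xy] .
  have inA: "?P n i \<in> A" if "i \<le> 2 ^ n" for n i
    using that by (auto simp: A_def)
  have xA: "x \<in> A" and yA: "y \<in> A"
    using inA[of 0 0] inA[of 1 0] by auto
  obtain \<sigma> where lip: "1-lipschitz_on {T x..T y} \<sigma>"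
    and \<sigma>_T: "\<And>p. p \<in> A \<Longrightarrow> \<sigma> (T p) = p"
    and \<sigma>_le: "\<And>s t. \<lbrakk>s \<in> {T x..T y}; t \<in> {T x..T y}; s < t\<rbrakk> \<Longrightarrow> le (\<sigma> s) (\<sigma> t)"
  proof (rule causal_chain_curve[of A "T x" "T y"])
    show "le p q \<or> le q p" if "p \<in> A" "q \<in> A" for p q
      using that dyadic_chain_total[OF xy] by (auto simp: A_def)
    show "T ` A \<subseteq> {T x..T y}"
      using dyadic_chain_T_bounds[OF xy] by (auto simp: A_def)
    show "{T x..T y} \<subseteq> closure (T ` A)"
      using dyadic_chain_dense[OF xy] by (simp add: A_def)
  qed blast
  have \<sigma>_ends: "\<sigma> (T x) = x" "\<sigma> (T y) = y"
    using \<sigma>_T xA yA by auto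
  have "directed_curve le {T x..T y} \<sigma>"
    unfolding directed_curve_def
  proof (intro conjI ballI impI)
    show "\<not> \<sigma> constant_on {T x..T y}"
      using \<sigma>_ends Txy unfolding constant_on_def
      by (metis atLeastAtMost_iff less_irrefl less_le_not_le order_refl)
    show "locally_lipschitz_on {T x..T y} \<sigma>"
      unfolding locally_lipschitz_on_def
      by (intro ballI exI[of _ 1] conjI) (auto intro: lipschitz_on_subset[OF lip])
  qed (auto intro: \<sigma>_le simp: is_interval_cc)
  then have curve: "directed_curve_from_to le (T x) (T y) \<sigma> x y"
    using \<sigma>_ends Txy by (simp add: directed_curve_from_to_def)

  \<comment> \<open>\<open>F\<close> recovers the dyadic parameter from the time.\<close>
  define D where "D s = {real i / 2 ^ n |n i. i \<le> 2 ^ n \<and> T (?P n i) \<le> s}" for s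
  define F where "F s = Sup (D s)" for s
  have D_le: "d \<le> 1" if "d \<in> D s" for d s
  proof -
    from that obtain n i where "d = real i / 2 ^ n" "i \<le> 2 ^ n"
      by (auto simp: D_def)
    then show ?thesis
      by (metis divide_le_eq_1_pos of_nat_le_iff of_nat_numeral of_nat_power zero_less_numeral
          zero_less_power)
  qed
  then have bdd: "bdd_above (D s)" for s
    by (auto simp: bdd_above_def)
  have D0: "0 \<in> D s" if "T x \<le> s" for s
    using that by (force simp: D_def dyadic_chain_0)
  have F_upper: "d \<le> F s" if "d \<in> D s" for d s
    unfolding F_def using that bdd by (rule cSup_upper)
  have F_bounds: "0 \<le> F s" "F s \<le> 1" if "T x \<le> s" for s
    unfolding F_def using D0[OF that] bdd D_le by (auto intro: cSup_upper cSup_least)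
  have F_mono: "F s \<le> F t" if "T x \<le> s" "s \<le> t" for s t
    unfolding F_def using D0[OF that(1)] that by (intro cSup_subset_mono bdd) (auto 0 4 simp: D_def intro: order_trans)
  have above: "s < T (?P n i)" if "i \<le> 2 ^ n" "F s < real i / 2 ^ n" for s n i
  proof (rule ccontr)
    assume "\<not> s < T (?P n i)"
    then have "T (?P n i) \<le> s"
      by simp
    then have "real i / 2 ^ n \<in> D s"
      using that(1) unfolding D_def by blast
    then show False
      using F_upper that(2) by fastforce
  qed
  have below: "T (?P n i) < t" if "T x \<le> t" "i \<le> 2 ^ n" "real i / 2 ^ n < F t" for t n i
  proof -
    have "\<exists>d\<in>D t. real i / 2 ^ n < d"
      using that(3) less_cSup_iff[OF _ bdd, of t] D0[OF that(1)] by (auto simp: F_def)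
    then obtain m j where mj: "j \<le> 2 ^ m" "T (?P m j) \<le> t" "real i / 2 ^ n < real j / 2 ^ m"
      by (auto simp: D_def)
    then show ?thesis
      using dyadic_chain_tau(2)[OF xy that(2) mj(1,3)] ll_imp_T_less by fastforce
  qed
  have weight: "ennreal (F t - F s) * \<tau> x y \<le> \<tau> (\<sigma> s) (\<sigma> t)"
    if st: "s \<in> {T x..T y}" "t \<in> {T x..T y}" "s < t" for s t
  proof (rule ennreal_mult_le_of_smaller_factors)
    \<comment> \<open>Choose dyadic parameters within \<open>h\<close> of \<open>F s\<close> and of \<open>F t\<close>; they still differ by \<open>w\<close>.\<close>
    fix w assume w: "0 < w" "w < F t - F s"
    define h where "h = (F t - F s - w) / 2"
    have h: "0 < h" "F t - h - (F s + h) = w"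
      using w by (auto simp: h_def field_simps)
    have F01: "0 \<le> F s" "F s < F s + h" "F s + h \<le> 1" "0 \<le> F t - h" "F t - h < F t" "F t \<le> 1"
      using F_bounds[of s] F_bounds[of t] st h w by auto
    obtain n i where i: "i \<le> 2 ^ n" "F s < real i / 2 ^ n" "real i / 2 ^ n < F s + h"
      using ex_dyadic_between[OF F01(1-3)] by blast
    obtain m j where j: "j \<le> 2 ^ m" "F t - h < real j / 2 ^ m" "real j / 2 ^ m < F t"
      using ex_dyadic_between[OF F01(4-6)] by blast
    have ij: "real i / 2 ^ n < real j / 2 ^ m" "w \<le> real j / 2 ^ m - real i / 2 ^ n"
      using i j h w by auto
    let ?p = "?P n i" and ?q = "?P m j"
    have pq: "ll ?p ?q"
      "ennreal (real j / 2 ^ m - real i / 2 ^ n) * \<tau> x y \<le> \<tau> ?p ?q"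
      using dyadic_chain_tau[OF xy i(1) j(1) ij(1)] by auto
    have "s < T ?p" "T ?q < t"
      using above[OF i(1,2)] below[OF _ j(1,3)] st by auto
    then have le: "le (\<sigma> s) ?p" "le ?q (\<sigma> t)"
      using \<sigma>_le[of s "T ?p"] \<sigma>_le[of "T ?q" t] \<sigma>_T inA i(1) j(1) st
        dyadic_chain_T_bounds[OF xy i(1)] dyadic_chain_T_bounds[OF xy j(1)] by auto
    have "ennreal w * \<tau> x y \<le> \<tau> ?p ?q"
      using ij(2) pq(2) by (meson ennreal_leI mult_right_mono order_trans zero_le)
    also have "\<dots> \<le> \<tau> (\<sigma> s) ?p + \<tau> ?p ?q"
      by simp
    also have "\<dots> \<le> \<tau> (\<sigma> s) ?q"
      using le pq ll_imp_le tau_reverse_triangle by blast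
    also have "\<dots> \<le> \<tau> (\<sigma> s) ?q + \<tau> ?q (\<sigma> t)"
      by simp
    also have "\<dots> \<le> \<tau> (\<sigma> s) (\<sigma> t)"
      using le pq ll_imp_le le_trans tau_reverse_triangle by blast
    finally show "ennreal w * \<tau> x y \<le> \<tau> (\<sigma> s) (\<sigma> t)" .
  qed
  have "F (T x) = 0"
  proof -
    have "d \<le> 0" if "d \<in> D (T x)" for d
    proof (rule ccontr)
      assume "\<not> d \<le> 0"
      with that obtain n i where i: "d = real i / 2 ^ n" "i \<le> 2 ^ n" "T (?P n i) \<le> T x" "0 < d"
        by (auto simp: D_def)
      then have "0 < i"
        by (cases i) auto
      then have "ll x (?P n i)"
        using dyadic_chain_tau_level[OF xy, of 0 i n] i by (simp add: dyadic_chain_0)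
      then show False
        using ll_imp_T_less i by fastforce
    qed
    then have "F (T x) \<le> 0"
      unfolding F_def using D0[of "T x"] by (intro cSup_least) auto
    then show ?thesis
      using F_bounds[of "T x"] by simp
  qed
  moreover have "F (T y) = 1"
  proof -
    have "1 \<in> D (T y)"
      by (auto simp: D_def intro!: exI[of _ "0::nat"] exI[of _ "1::nat"])
    then have "1 \<le> F (T y)"
      by (rule F_upper)
    then show ?thesis
      using F_bounds[of "T y"] Txy by simp
  qed
  moreover have "ennreal (F (T y) - F (T x)) * \<tau> x y \<le> tau_length \<tau> (T x) (T y) \<sigma>"
    by (rule tau_length_ge_of_weight) (auto intro: F_mono weight)
  ultimately have "\<tau> x y \<le> tau_length \<tau> (T x) (T y) \<sigma>"
    by simp
  moreover have "tau_length \<tau> (T x) (T y) \<sigma> \<le> \<tau> x y"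
  proof -
    define t where "t i = (if i = 0 then T x else T y)" for i :: nat
    have "is_partition (T x) (T y) 1 t"
      using Txy by (simp add: is_partition_def t_def)
    moreover have "\<tau> x y = (\<Sum>i<1. \<tau> (\<sigma> (t i)) (\<sigma> (t (Suc i))))"
      by (simp add: t_def \<sigma>_ends)
    ultimately show ?thesis
      unfolding tau_length_def by (intro Inf_lower) blast
  qed
  ultimately have "distance_realizer le \<tau> (T x) (T y) \<sigma> x y"
    using curve by (simp add: distance_realizer_def)
  then show ?thesis
    by (rule that)
qed

end


section \<open>Existence of geodesics\<close>

theorem theorem3p2:
  fixes ll le :: "'a::metric_space \<Rightarrow> 'a \<Rightarrow> bool"
    and \<tau> :: "'a \<Rightarrow> 'a \<Rightarrow> ennreal"
    and T :: "'a \<Rightarrow> real"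
    and c :: real
  assumes "lorentzian_pre_length_space ll le \<tau>"
    and "locally_causally_closed le"
    and "sufficiently_causally_connected ll le"
    and "is_time_function le T"
    and "locally_anti_lipschitz le T"
    and "\<And>p q. ereal (dist p q) = null_distance le T p q"
    and "complete (UNIV :: 'a set)"
    and "has_tau_midpoints ll \<tau>"
    and "0 < c" and "c \<le> 1 / 2"
    and "\<And>p q. ll p q \<Longrightarrow>
           \<exists>m. tau_midpoint \<tau> p q m \<and>
               (1 - c) * T p + c * T q \<le> T m \<and> T m \<le> c * T p + (1 - c) * T q"
  shows "causally_geodesic ll le \<tau>"
proof -
  interpret lorentzian_pre_length_space ll le \<tau> by fact
  have conn: "causally_path_connected ll le"
    using assms(3) by (simp add: sufficiently_causally_connected_def)
  have time: "is_generalized_time_function le T" and cont: "continuous_on UNIV T"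
    using assms(4) by (auto simp: is_time_function_def)
  obtain mid where mid: "\<And>p q. ll p q \<Longrightarrow> tau_midpoint \<tau> p q (mid p q) \<and>
      (1 - c) * T p + c * T q \<le> T (mid p q) \<and> T (mid p q) \<le> c * T p + (1 - c) * T q"
    using assms(11) by metis
  interpret midpoint_time_space ll le \<tau> T c mid
    using assms(2,7,9,10) cont mid dist_le_time_difference[OF conn time assms(6)]
      timelike_imp_time_less[OF conn time ll_imp_le]
    by unfold_locales auto
  have "geodesic_space ll le \<tau>"
    unfolding geodesic_space_def by (meson ex_distance_realizer)
  moreover have "\<exists>a b \<gamma>. directed_curve_from_to le a b \<gamma> x y"
    if "null_related ll le x y" "x \<noteq> y" for x y
    using conn that by (auto simp: causally_path_connected_def null_related_def strictly_before_def)
  ultimately show ?thesis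
    by (simp add: causally_geodesic_def)
qed

end
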